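(* Let $n\ge 2$ be an integer, let $S_n=K_{1,n-1}$ be the star graph on $n$ vertices, and let $f\colon S_n\to\mathbb{R}$ be any critical discrete Morse function. Then $i(M_f)=1$, where $M_f$ is the merge tree induced by $f$.
   Context: Graphs are finite and simple; a \emph{simplex} of a graph is a vertex or an edge. A function $f$ from the set of simplices of a graph $G$ to $\mathbb{R}$ (written $f\colon G\to\mathbb{R}$) is a \emph{discrete Morse function} if (i) $f(v)\le f(e)$ whenever $v$ is an endpoint of the edge $e$; (ii) $f$ is at most 2--1 (each value is taken by at most two simplices); (iii) if $f(\sigma)=f(\tau)$ then $\sigma\subseteq\tau$ or $\tau\subseteq\sigma$. A simplex $\sigma$ is \emph{critical} if no other simplex has the value $f(\sigma)$. A discrete Morse function is called \emph{critical} if every simplex is critical, i.e. $f$ is injective. A \emph{binary tree} is a rooted tree in which each vertex has at most two children, each child being designated as the left (L) or the right (R) child, with at most one of each. It is \emph{full} if every vertex has $0$ or $2$ children. A \emph{merge tree} is a full binary tree. Its vertices are called nodes. A node with exactly one neighbor is a \emph{leaf}; a node with more than one neighbor is an \emph{internal node}. An internal node adjacent to exactly two leaves is an \emph{impasse}; $i(M)$ is the number of impasses of $M$. Construction of $M_f$ for a critical discrete Morse function $f$ on a tree $T$ with at least one edge. For a value $c$ of $f$ let $T_{c-\epsilon}$ be the subgraph of $T$ consisting of all simplices $\sigma$ with $f(\sigma)<c$, and for a vertex $w$ of it let $T_{c-\epsilon}[w]$ be the connected component containing $w$. Each node $x$ of $M_f$ carries a real label $f_M(x)$, which is a value of $f$,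 and a direction L or R. (1) Start with a root node, labeled by the largest value of $f$ (which is attained on an edge), with direction L. (2) Whenever a node $x$ has label $c=f(uv)$ for an edge $uv$ of $T$, create two children $n_u,n_v$ of $x$ with labels $f_M(n_u)=\max\{f(\sigma):\sigma\in T_{c-\epsilon}[u]\}$ and $f_M(n_v)=\max\{f(\sigma):\sigma\in T_{c-\epsilon}[v]\}$. If $\min\{f(\sigma):\sigma\in T_{c-\epsilon}[u]\}<\min\{f(\sigma):\sigma\in T_{c-\epsilon}[v]\}$, give $n_u$ the same direction as $x$ and $n_v$ the opposite direction; if the reverse inequality holds, give $n_v$ the same direction as $x$ and $n_u$ the opposite direction. The child with direction L is the left child and the child with direction R is the right child. (3) A node whose label is the value of a vertex gets no children. Continue until all nodes labeled by edges have been given children. *)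

theory Defs
  imports Complex_Main "HOL-Library.Tree"
begin

(* A finite simple graph is given by its vertex set V and its edge set E, an edge being a
   two-element set of vertices.  A vertex v is identified with the simplex {v}. *)

definition simple_graph :: "'a set \<Rightarrow> 'a set set \<Rightarrow> bool" where
  "simple_graph V E \<longleftrightarrow> finite V \<and> E \<subseteq> {{u, v} | u v. u \<in> V \<and> v \<in> V \<and> u \<noteq> v}"

definition simplices :: "'a set \<Rightarrow> 'a set set \<Rightarrow> 'a set set" where
  "simplices V E = (\<lambda>v. {v}) ` V \<union> E"

definition complete_bipartite :: "nat \<Rightarrow> nat \<Rightarrow> 'a set \<Rightarrow> 'a set set \<Rightarrow> bool" where
  "complete_bipartite r s V E \<longleftrightarrow>
     (\<exists>A B. finite A \<and> finite B \<and> card A = r \<and> card B = s \<and> A \<inter> B = {} \<and>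
        V = A \<union> B \<and> E = {{a, b} | a b. a \<in> A \<and> b \<in> B})"

definition star_graph :: "nat \<Rightarrow> 'a set \<Rightarrow> 'a set set \<Rightarrow> bool" where
  "star_graph n V E \<longleftrightarrow> complete_bipartite 1 (n - 1) V E"

lemma complete_bipartite_simple_graph:
  "complete_bipartite r s V E \<Longrightarrow> simple_graph V E"
  unfolding complete_bipartite_def simple_graph_def by fast

(* Only the values of f on simplices matter. *)

definition discrete_morse :: "'a set \<Rightarrow> 'a set set \<Rightarrow> ('a set \<Rightarrow> real) \<Rightarrow> bool" where
  "discrete_morse V E f \<longleftrightarrow>
     (\<forall>v\<in>V. \<forall>e\<in>E. v \<in> e \<longrightarrow> f {v} \<le> f e) \<and>
     (\<forall>x. card {\<sigma> \<in> simplices V E. f \<sigma> = x} \<le> 2) \<and>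
     (\<forall>\<sigma>\<in>simplices V E. \<forall>\<tau>\<in>simplices V E. f \<sigma> = f \<tau> \<longrightarrow> \<sigma> \<subseteq> \<tau> \<or> \<tau> \<subseteq> \<sigma>)"

definition critical_simplex :: "'a set \<Rightarrow> 'a set set \<Rightarrow> ('a set \<Rightarrow> real) \<Rightarrow> 'a set \<Rightarrow> bool" where
  "critical_simplex V E f \<sigma> \<longleftrightarrow> \<sigma> \<in> simplices V E \<and> (\<forall>\<tau>\<in>simplices V E. f \<tau> = f \<sigma> \<longrightarrow> \<tau> = \<sigma>)"

definition critical_discrete_morse :: "'a set \<Rightarrow> 'a set set \<Rightarrow> ('a set \<Rightarrow> real) \<Rightarrow> bool" where
  "critical_discrete_morse V E f \<longleftrightarrow>
     discrete_morse V E f \<and> (\<forall>\<sigma>\<in>simplices V E. critical_simplex V E f \<sigma>)"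

lemma critical_discrete_morse_inj_on:
  "critical_discrete_morse V E f \<Longrightarrow> inj_on f (simplices V E)"
  unfolding critical_discrete_morse_def critical_simplex_def inj_on_def by blast

(* Binary trees are values of type 'b tree other than the empty tree Leaf of HOL-Library.Tree;
   Leaf stands for an absent child.  A node is identified with the path leading to it
   from the root. *)

datatype direction = LeftDir | RightDir

fun opposite :: "direction \<Rightarrow> direction" where
  "opposite LeftDir = RightDir"
| "opposite RightDir = LeftDir"

fun tree_nodes :: "'b tree \<Rightarrow> direction list set" where
  "tree_nodes \<langle>\<rangle> = {}"
| "tree_nodes \<langle>l, x, r\<rangle> = {[]} \<union> (#) LeftDir ` tree_nodes l \<union> (#) RightDir ` tree_nodes r"

fun full_binary :: "'b tree \<Rightarrow> bool" where
  "full_binary \<langle>\<rangle> = False"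
| "full_binary \<langle>l, x, r\<rangle> = (l = \<langle>\<rangle> \<and> r = \<langle>\<rangle> \<or> full_binary l \<and> full_binary r)"

definition neighbours :: "'b tree \<Rightarrow> direction list \<Rightarrow> direction list set" where
  "neighbours M p = {q \<in> tree_nodes M. \<exists>d. q = p @ [d] \<or> p = q @ [d]}"

definition leaf_node :: "'b tree \<Rightarrow> direction list \<Rightarrow> bool" where
  "leaf_node M p \<longleftrightarrow> p \<in> tree_nodes M \<and> card (neighbours M p) = 1"

definition internal_node :: "'b tree \<Rightarrow> direction list \<Rightarrow> bool" where
  "internal_node M p \<longleftrightarrow> p \<in> tree_nodes M \<and> card (neighbours M p) > 1"

definition impasse :: "'b tree \<Rightarrow> direction list \<Rightarrow> bool" where
  "impasse M p \<longleftrightarrow> internal_node M p \<and> card {q \<in> neighbours M p. leaf_node M q} = 2"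

definition num_impasses :: "'b tree \<Rightarrow> nat" where
  "num_impasses M = card {p. impasse M p}"

definition component :: "'a set \<Rightarrow> 'a set set \<Rightarrow> 'a \<Rightarrow> 'a set set" where
  "component V E w = {\<sigma> \<in> simplices V E. \<sigma> \<subseteq> {v. (w, v) \<in> {(x, y). {x, y} \<in> E}\<^sup>*}}"

(* The simplices of the component of w in the subgraph of simplices of value less than c. *)
definition sublevel_component ::
    "'a set \<Rightarrow> 'a set set \<Rightarrow> ('a set \<Rightarrow> real) \<Rightarrow> real \<Rightarrow> 'a \<Rightarrow> 'a set set" where
  "sublevel_component V E f c w = component {v \<in> V. f {v} < c} {e \<in> E. f e < c} w"

definition component_max :: "'a set \<Rightarrow> 'a set set \<Rightarrow> ('a set \<Rightarrow> real) \<Rightarrow> real \<Rightarrow> 'a \<Rightarrow> real" where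
  "component_max V E f c w = Max (f ` sublevel_component V E f c w)"

definition component_min :: "'a set \<Rightarrow> 'a set set \<Rightarrow> ('a set \<Rightarrow> real) \<Rightarrow> real \<Rightarrow> 'a \<Rightarrow> real" where
  "component_min V E f c w = Min (f ` sublevel_component V E f c w)"

(* The ends of the edge of value c, in an arbitrary order; the order turns out not to matter,
   see merge_subtree_edge below. *)
definition edge_ends :: "'a set set \<Rightarrow> ('a set \<Rightarrow> real) \<Rightarrow> real \<Rightarrow> 'a \<times> 'a" where
  "edge_ends E f c = (SOME (u, v). {u, v} \<in> E \<and> f {u, v} = c)"

(* The subtree below a node with label c and direction d.  Nodes carry their label and
   direction.  The recursion is not total for arbitrary V, E, f; termination for critical discrete
   Morse functions on finite simple graphs is merge_subtree_dom_critical below. *)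
function (domintros) merge_subtree ::
    "'a set \<Rightarrow> 'a set set \<Rightarrow> ('a set \<Rightarrow> real) \<Rightarrow> real \<Rightarrow> direction \<Rightarrow> (real \<times> direction) tree" where
  "merge_subtree V E f c d =
     (if \<exists>e\<in>E. f e = c then
        let u = fst (edge_ends E f c);
            v = snd (edge_ends E f c);
            du = (if component_min V E f c u < component_min V E f c v then d else opposite d);
            tu = merge_subtree V E f (component_max V E f c u) du;
            tv = merge_subtree V E f (component_max V E f c v) (opposite du)
        in if du = LeftDir then \<langle>tu, (c, d), tv\<rangle> else \<langle>tv, (c, d), tu\<rangle>
      else \<langle>\<langle>\<rangle>, (c, d), \<langle>\<rangle>\<rangle>)"
  by pat_completeness auto

definition merge_tree :: "'a set \<Rightarrow> 'a set set \<Rightarrow> ('a set \<Rightarrow> real) \<Rightarrow> (real \<times> direction) tree" where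
  "merge_tree V E f = merge_subtree V E f (Max (f ` simplices V E)) LeftDir"

lemma opposite_opposite [simp]: "opposite (opposite d) = d"
  by (cases d) auto

lemma edge_ends_edge:
  assumes "e \<in> E" "f e = c" "simple_graph V E"
  shows "{fst (edge_ends E f c), snd (edge_ends E f c)} \<in> E"
    and "f {fst (edge_ends E f c), snd (edge_ends E f c)} = c"
proof -
  obtain u v where "e = {u, v}"
    using assms(1,3) unfolding simple_graph_def by blast
  then have "case (u, v) of (u, v) \<Rightarrow> {u, v} \<in> E \<and> f {u, v} = c"
    using assms by simp
  then have "case edge_ends E f c of (u, v) \<Rightarrow> {u, v} \<in> E \<and> f {u, v} = c"
    unfolding edge_ends_def by (rule someI)
  then show "{fst (edge_ends E f c), snd (edge_ends E f c)} \<in> E"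
    and "f {fst (edge_ends E f c), snd (edge_ends E f c)} = c"
    by (auto split: prod.splits)
qed

lemma finite_simplices:
  assumes "simple_graph V E"
  shows "finite (simplices V E)"
proof -
  have "E \<subseteq> Pow V" using assms unfolding simple_graph_def by auto
  then show ?thesis
    using assms finite_subset unfolding simplices_def simple_graph_def by blast
qed

lemma vertex_less_edge:
  assumes "simple_graph V E" "critical_discrete_morse V E f" "e \<in> E" "w \<in> e"
  shows "w \<in> V" and "f {w} < f e"
proof -
  show wV: "w \<in> V" using assms unfolding simple_graph_def by blast
  have "e \<noteq> {w}" using assms(1,3) unfolding simple_graph_def by (auto simp: doubleton_eq_iff)
  then have "f {w} \<noteq> f e"
    using critical_discrete_morse_inj_on[OF assms(2)] wV assms(3)
    unfolding inj_on_def simplices_def by blast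
  moreover have "f {w} \<le> f e"
    using assms wV unfolding critical_discrete_morse_def discrete_morse_def by blast
  ultimately show "f {w} < f e" by simp
qed

lemma component_max_less:
  assumes "simple_graph V E" "critical_discrete_morse V E f" "e \<in> E" "w \<in> e"
  shows "component_max V E f (f e) w \<in> f ` simplices V E"
    and "component_max V E f (f e) w < f e"
proof -
  let ?C = "sublevel_component V E f (f e) w"
  have sub: "?C \<subseteq> {\<sigma> \<in> simplices V E. f \<sigma> < f e}"
    unfolding sublevel_component_def component_def simplices_def by auto
  then have "finite ?C" using finite_simplices[OF assms(1)] finite_subset by fastforce
  moreover have "{w} \<in> ?C"
    using vertex_less_edge[OF assms]
    unfolding sublevel_component_def component_def simplices_def by auto
  ultimately have "component_max V E f (f e) w \<in> f ` ?C"
    unfolding component_max_def by (intro Max_in) auto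
  then show "component_max V E f (f e) w \<in> f ` simplices V E"
    and "component_max V E f (f e) w < f e"
    using sub by auto
qed

theorem merge_subtree_dom_critical:
  assumes "simple_graph V E" "critical_discrete_morse V E f"
  shows "merge_subtree_dom (V, E, f, c, d)"
proof (induction "card {\<sigma> \<in> simplices V E. f \<sigma> < c}" arbitrary: c d rule: less_induct)
  case less
  have step: "merge_subtree_dom (V, E, f, component_max V E f c w, d')"
    if "e \<in> E" "f e = c" "w \<in> {fst (edge_ends E f c), snd (edge_ends E f c)}" for e w d'
  proof (rule less)
    let ?e = "{fst (edge_ends E f c), snd (edge_ends E f c)}"
    have e: "?e \<in> E" "f ?e = c" using edge_ends_edge[of e E f c, OF that(1,2) assms(1)] by auto
    note m = component_max_less[OF assms e(1) that(3), unfolded e(2)]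
    have "{\<sigma> \<in> simplices V E. f \<sigma> < component_max V E f c w} \<subset> {\<sigma> \<in> simplices V E. f \<sigma> < c}"
      using m by force
    then show "card {\<sigma> \<in> simplices V E. f \<sigma> < component_max V E f c w}
                 < card {\<sigma> \<in> simplices V E. f \<sigma> < c}"
      using finite_simplices[OF assms(1)] by (intro psubset_card_mono) auto
  qed
  show ?case
    by (rule merge_subtree.domintros) (use step in auto)
qed

lemma full_binary_merge_subtree:
  assumes "merge_subtree_dom (V, E, f, c, d)"
  shows "full_binary (merge_subtree V E f c d)"
  using assms
proof (induction rule: merge_subtree.pinduct)
  case (1 V E f c d)
  show ?case
  proof (cases "\<exists>e\<in>E. f e = c")
    case True
    note IH = "1.IH"[OF True refl refl refl]
    show ?thesis
      using IH(1) IH(2)[OF refl] True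
      by (subst merge_subtree.psimps[OF 1(1)]) (cases d; auto simp: Let_def split: if_splits)
  next
    case False
    then show ?thesis by (subst merge_subtree.psimps[OF 1(1)]) simp
  qed
qed

lemma merge_subtree_edge:
  assumes "simple_graph V E" "critical_discrete_morse V E f"
    and "{u, v} \<in> E" "f {u, v} = c"
    and "component_min V E f c u < component_min V E f c v"
  shows "merge_subtree V E f c d =
     (let tu = merge_subtree V E f (component_max V E f c u) d;
          tv = merge_subtree V E f (component_max V E f c v) (opposite d)
      in if d = LeftDir then \<langle>tu, (c, d), tv\<rangle> else \<langle>tv, (c, d), tu\<rangle>)"
proof -
  let ?e = "{fst (edge_ends E f c), snd (edge_ends E f c)}"
  have e: "?e \<in> E" "f ?e = c" using edge_ends_edge[of "{u, v}" E f c, OF assms(3,4,1)] by auto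
  have "?e = {u, v}"
    using critical_discrete_morse_inj_on[OF assms(2)] e assms(3,4)
    unfolding inj_on_def simplices_def by blast
  then have "edge_ends E f c = (u, v) \<or> edge_ends E f c = (v, u)"
    by (metis doubleton_eq_iff prod.collapse)
  moreover have "\<exists>e\<in>E. f e = c" using assms(3,4) by blast
  moreover note merge_subtree.psimps[OF merge_subtree_dom_critical[OF assms(1,2), of c d]]
  ultimately show ?thesis using assms(5)
    by (cases d) (auto simp: Let_def)
qed

end

(* In a star, removing the edge of value c together with everything above it isolates the end of
   that edge other than the centre.  So every node of the merge tree labelled by an edge has a
   child that is a leaf, and the merge tree is a caterpillar; only the last node of its spine has
   two leaves as children. *)
theory Submission
  imports Defs
begin

lemma tree_nodes_append: "p @ q \<in> tree_nodes M \<Longrightarrow> p \<in> tree_nodes M"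
proof (induction M arbitrary: p)
  case (Node l x r)
  then show ?case by (cases p) auto
qed simp

lemma Nil_in_tree_nodes_iff: "[] \<in> tree_nodes M \<longleftrightarrow> M \<noteq> \<langle>\<rangle>"
  by (cases M) auto

text \<open>Children come in pairs, so testing for the left child alone decides whether a node has
  children; the characterisations of leaves, internal nodes and impasses rely on this.\<close>

lemma full_binary_sibling:
  "full_binary M \<Longrightarrow> p @ [d] \<in> tree_nodes M \<Longrightarrow> p @ [d'] \<in> tree_nodes M"
proof (induction M arbitrary: p)
  case (Node l x r)
  show ?case
  proof (cases p)
    case Nil
    moreover have "l \<noteq> \<langle>\<rangle> \<and> r \<noteq> \<langle>\<rangle>"
      using Node.prems Nil by (cases d) (auto simp: Nil_in_tree_nodes_iff)
    ultimately show ?thesis by (cases d') (auto simp: Nil_in_tree_nodes_iff)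
  next
    case (Cons c q)
    then show ?thesis using Node by (cases c) auto
  qed
qed simp

lemma neighbours_eq:
  assumes "full_binary M" "p \<in> tree_nodes M"
  shows "neighbours M p =
    (if p @ [LeftDir] \<in> tree_nodes M then {p @ [LeftDir], p @ [RightDir]} else {}) \<union>
    (if p = [] then {} else {butlast p})"
proof -
  have children: "{q \<in> tree_nodes M. \<exists>d. q = p @ [d]} =
      (if p @ [LeftDir] \<in> tree_nodes M then {p @ [LeftDir], p @ [RightDir]} else {})"
    using full_binary_sibling[OF assms(1), of p] by (auto split: if_splits) (metis direction.exhaust)
  have parent: "{q \<in> tree_nodes M. \<exists>d. p = q @ [d]} = (if p = [] then {} else {butlast p})"
  proof (cases p rule: rev_cases)
    case (snoc q d)
    then show ?thesis using assms(2) tree_nodes_append[of q "[d]"] by auto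
  qed simp
  show ?thesis
    unfolding neighbours_def children[symmetric] parent[symmetric] by blast
qed

text \<open>A childless node has at most its parent as neighbour. The root of a one-node tree has no
  neighbour at all and so is not a leaf, whence \<open>p \<noteq> []\<close>.\<close>

lemma leaf_node_iff:
  assumes "full_binary M"
  shows "leaf_node M p \<longleftrightarrow> p \<in> tree_nodes M \<and> p \<noteq> [] \<and> p @ [LeftDir] \<notin> tree_nodes M"
proof (cases "p \<in> tree_nodes M")
  case True
  have "card {x, p @ [LeftDir], p @ [RightDir]} \<noteq> Suc 0" for x
    by (auto simp: card_1_singleton_iff)
  then show ?thesis
    using True by (auto simp: leaf_node_def neighbours_eq[OF assms True])
qed (simp add: leaf_node_def)

lemma internal_node_iff:
  assumes "full_binary M"
  shows "internal_node M p \<longleftrightarrow> p @ [LeftDir] \<in> tree_nodes M"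
proof (cases "p \<in> tree_nodes M")
  case True
  \<comment> \<open>The two children bound the degree from below; \<open>A\<close> will be empty or
    hold the parent, about which nothing has to be known.\<close>
  have "card {p @ [LeftDir], p @ [RightDir]} \<le> card ({p @ [LeftDir], p @ [RightDir]} \<union> A)"
    if "finite A" for A
    using that by (intro card_mono) auto
  then have "1 < card ({p @ [LeftDir], p @ [RightDir]} \<union> A)" if "finite A" for A
    using that by fastforce
  from this[of "{}"] this[of "{butlast p}"] show ?thesis
    using True by (auto simp: internal_node_def neighbours_eq[OF assms True])
qed (auto simp: internal_node_def dest: tree_nodes_append)

lemma impasse_iff:
  assumes "full_binary M"
  shows "impasse M p \<longleftrightarrow> p @ [LeftDir] \<in> tree_nodes M \<and>
    p @ [LeftDir, LeftDir] \<notin> tree_nodes M \<and> p @ [RightDir, LeftDir] \<notin> tree_nodes M"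
proof (cases "p @ [LeftDir] \<in> tree_nodes M")
  case True
  note R = full_binary_sibling[OF assms True]
  note p = tree_nodes_append[OF True]
  \<comment> \<open>The parent has \<open>p\<close> as a child, hence also a left child, so it is no
    leaf. Only the children of \<open>p\<close> can make it an impasse.\<close>
  have "\<not> leaf_node M (butlast p)" if "p \<noteq> []"
    using p that full_binary_sibling[OF assms, of "butlast p" "last p"]
    by (simp add: leaf_node_iff[OF assms])
  then have "{q \<in> neighbours M p. leaf_node M q}
      = {q \<in> {p @ [LeftDir], p @ [RightDir]}. q @ [LeftDir] \<notin> tree_nodes M}"
    using True R by (auto simp: neighbours_eq[OF assms p] leaf_node_iff[OF assms] split: if_splits)
  also have "\<dots> = (if p @ [LeftDir, LeftDir] \<notin> tree_nodes M then {p @ [LeftDir]} else {}) \<union>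
      (if p @ [RightDir, LeftDir] \<notin> tree_nodes M then {p @ [RightDir]} else {})"
    by auto
  finally show ?thesis
    using True by (simp add: impasse_def internal_node_iff[OF assms])
qed (simp add: impasse_def internal_node_iff[OF assms])

text \<open>The spine grows upwards from its only impasse, which \<open>both\<close> creates;
  \<open>left\<close> and \<open>right\<close> are named after the side on which it continues. A
  single node is left out since it has no impasse.\<close>

inductive caterpillar :: "'b tree \<Rightarrow> bool" where
  both: "caterpillar \<langle>\<langle>\<langle>\<rangle>, x, \<langle>\<rangle>\<rangle>, y, \<langle>\<langle>\<rangle>, z, \<langle>\<rangle>\<rangle>\<rangle>"
| left: "caterpillar l \<Longrightarrow> caterpillar \<langle>l, y, \<langle>\<langle>\<rangle>, z, \<langle>\<rangle>\<rangle>\<rangle>"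
| right: "caterpillar r \<Longrightarrow> caterpillar \<langle>\<langle>\<langle>\<rangle>, x, \<langle>\<rangle>\<rangle>, y, r\<rangle>"

lemma caterpillar_full_binary: "caterpillar M \<Longrightarrow> full_binary M"
  by (induction rule: caterpillar.induct) auto

text \<open>Ensures that the spine child of a new root is not a leaf, so that this root is no
  impasse.\<close>

lemma caterpillar_children: "caterpillar M \<Longrightarrow> [d] \<in> tree_nodes M"
proof -
  have nonempty: "M \<noteq> \<langle>\<rangle>" if "caterpillar M" for M :: "'b tree"
    using that caterpillar_full_binary by force
  show "caterpillar M \<Longrightarrow> [d] \<in> tree_nodes M"
    by (induction rule: caterpillar.induct; cases d)
      (auto simp: Nil_in_tree_nodes_iff dest: nonempty)
qed

text \<open>Neither a root added by \<open>left\<close> or \<open>right\<close> nor its leaf child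
  is an impasse, so the impasses are those of the smaller caterpillar with one direction put in
  front.\<close>

lemma caterpillar_impasse: "caterpillar M \<Longrightarrow> \<exists>p. {q. impasse M q} = {p}"
proof (induction rule: caterpillar.induct)
  case (both x y z)
  let ?M = "\<langle>\<langle>\<langle>\<rangle>, x, \<langle>\<rangle>\<rangle>, y, \<langle>\<langle>\<rangle>, z, \<langle>\<rangle>\<rangle>\<rangle>"
  have "impasse ?M q \<longleftrightarrow> q = []" for q
    by (subst impasse_iff) (cases q; auto)+
  then show ?case by auto
next
  case (left l y z)
  let ?M = "\<langle>l, y, \<langle>\<langle>\<rangle>, z, \<langle>\<rangle>\<rangle>\<rangle>"
  note full = caterpillar_full_binary[OF left.hyps]
  have "full_binary ?M" using full by simp
  then have "impasse ?M q \<longleftrightarrow> q \<in> (#) LeftDir ` {q. impasse l q}" for q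
    using caterpillar_children[OF left.hyps, of LeftDir]
    by (cases q) (auto simp: impasse_iff full)
  then show ?case using left.IH by auto
next
  case (right r x y)
  let ?M = "\<langle>\<langle>\<langle>\<rangle>, x, \<langle>\<rangle>\<rangle>, y, r\<rangle>"
  note full = caterpillar_full_binary[OF right.hyps]
  have "full_binary ?M" using full by simp
  then have "impasse ?M q \<longleftrightarrow> q \<in> (#) RightDir ` {q. impasse r q}" for q
    using caterpillar_children[OF right.hyps, of LeftDir]
    by (cases q) (auto simp: impasse_iff full)
  then show ?case using right.IH by auto
qed

lemma merge_subtree_vertex:
  assumes "simple_graph V E" "critical_discrete_morse V E f" "v \<in> V"
  shows "merge_subtree V E f (f {v}) d = \<langle>\<langle>\<rangle>, (f {v}, d), \<langle>\<rangle>\<rangle>"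
proof -
  have "f e \<noteq> f {v}" if "e \<in> E" for e
  proof
    assume "f e = f {v}"
    then have "e = {v}"
      using critical_discrete_morse_inj_on[OF assms(2)] that assms(3)
      unfolding inj_on_def simplices_def by blast
    then show False
      using vertex_less_edge(2)[OF assms(1,2) that, of v] by simp
  qed
  then show ?thesis
    using merge_subtree.psimps[OF merge_subtree_dom_critical[OF assms(1,2)], of "f {v}" d] by auto
qed

text \<open>\<open>edge_ends\<close> and the comparison of minima only settle sides and directions.
  Being a caterpillar depends on neither, so they are left open here, in contrast to
  \<open>merge_subtree_edge\<close>.\<close>

lemma merge_subtree_edge_cases:
  assumes "simple_graph V E" "critical_discrete_morse V E f" "{a, b} \<in> E" "f {a, b} = c"
  obtains da db where
      "merge_subtree V E f c d = \<langle>merge_subtree V E f (component_max V E f c a) da, (c, d),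
         merge_subtree V E f (component_max V E f c b) db\<rangle>"
    | da db where
      "merge_subtree V E f c d = \<langle>merge_subtree V E f (component_max V E f c b) db, (c, d),
         merge_subtree V E f (component_max V E f c a) da\<rangle>"
proof -
  let ?e = "{fst (edge_ends E f c), snd (edge_ends E f c)}"
  have e: "?e \<in> E" "f ?e = c" using edge_ends_edge[of "{a, b}" E f c, OF assms(3,4,1)] by auto
  have "?e = {a, b}"
    using critical_discrete_morse_inj_on[OF assms(2)] e assms(3,4)
    unfolding inj_on_def simplices_def by blast
  then have ends: "edge_ends E f c = (a, b) \<or> edge_ends E f c = (b, a)"
    by (metis doubleton_eq_iff prod.collapse)
  have ex: "\<exists>e\<in>E. f e = c" using assms(3,4) by blast
  note eq = merge_subtree.psimps[OF merge_subtree_dom_critical[OF assms(1,2), of c d]]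
  show thesis
    by (rule disjE[OF ends]; insert that eq ex; simp add: Let_def split: if_splits)
qed

text \<open>If the empty set were an edge, it would lie in every component, since membership is
  tested by inclusion; hence the second assumption.\<close>

lemma component_isolated:
  assumes "w \<in> V" "{} \<notin> E" "\<And>e. e \<in> E \<Longrightarrow> w \<notin> e"
  shows "component V E w = {{w}}"
proof -
  \<comment> \<open>A nontrivial walk from \<open>w\<close> would start with an edge containing
    \<open>w\<close>.\<close>
  have "v = w" if "(w, v) \<in> {(x, y). {x, y} \<in> E}\<^sup>*" for v
    using that by (cases rule: converse_rtranclE) (use assms(3) in auto)
  then have "{v. (w, v) \<in> {(x, y). {x, y} \<in> E}\<^sup>*} = {w}" by auto
  then show ?thesis
    using assms unfolding component_def simplices_def by (auto simp: subset_singleton_iff)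
qed

text \<open>The only edge at \<open>b\<close> is \<open>e\<close>, whose value is not below itself,
  so \<open>b\<close> is an isolated vertex of the sublevel graph.\<close>

lemma component_max_pendant:
  assumes "simple_graph V E" "critical_discrete_morse V E f" "e \<in> E" "b \<in> e"
    and "\<And>e'. e' \<in> E \<Longrightarrow> b \<in> e' \<Longrightarrow> e' = e"
  shows "component_max V E f (f e) b = f {b}"
proof -
  have "{} \<notin> E" using assms(1) unfolding simple_graph_def by blast
  then have "sublevel_component V E f (f e) b = {{b}}"
    unfolding sublevel_component_def
    using vertex_less_edge[OF assms(1-4)] assms(5) by (intro component_isolated) auto
  then show ?thesis by (simp add: component_max_def)
qed

text \<open>\<open>pendant\<close> keeps from the star only what the argument needs. The induction
  measure is the one that proves termination of \<open>merge_subtree\<close>.\<close>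

lemma caterpillar_merge_subtree:
  assumes "simple_graph V E" "critical_discrete_morse V E f"
    and pendant: "\<And>e. e \<in> E \<Longrightarrow> \<exists>a b. e = {a, b} \<and> (\<forall>e'\<in>E. b \<in> e' \<longrightarrow> e' = e)"
    and "e \<in> E"
  shows "caterpillar (merge_subtree V E f (f e) d)"
  using \<open>e \<in> E\<close>
proof (induction "card {\<sigma> \<in> simplices V E. f \<sigma> < f e}" arbitrary: e d rule: less_induct)
  case less
  obtain a b where e: "e = {a, b}" and b: "\<And>e'. e' \<in> E \<Longrightarrow> b \<in> e' \<Longrightarrow> e' = e"
    using pendant[OF less.prems] by blast
  note vertex = merge_subtree_vertex[OF assms(1,2)]
  have "component_max V E f (f e) b = f {b}"
    using component_max_pendant[OF assms(1,2) less.prems, of b] b e by blast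
  then have B: "merge_subtree V E f (component_max V E f (f e) b) d' = \<langle>\<langle>\<rangle>, (f {b}, d'), \<langle>\<rangle>\<rangle>" for d'
    using vertex vertex_less_edge(1)[OF assms(1,2) less.prems, of b] e by simp
  have a: "component_max V E f (f e) a \<in> f ` simplices V E" "component_max V E f (f e) a < f e"
    using component_max_less[OF assms(1,2) less.prems, of a] e by auto
  \<comment> \<open>The label on the side of \<open>a\<close> is the value of a vertex, giving a
    single node, or of an edge below \<open>f e\<close>, to which the induction hypothesis
    applies.\<close>
  have A: "caterpillar (merge_subtree V E f (component_max V E f (f e) a) d') \<or>
     (\<exists>x. merge_subtree V E f (component_max V E f (f e) a) d' = \<langle>\<langle>\<rangle>, x, \<langle>\<rangle>\<rangle>)" for d'
  proof -
    from a(1) consider v where "v \<in> V" "component_max V E f (f e) a = f {v}"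
      | e' where "e' \<in> E" "component_max V E f (f e) a = f e'"
      unfolding simplices_def by auto
    then show ?thesis
    proof cases
      case 1
      then show ?thesis using vertex by auto
    next
      case 2
      have "{\<sigma> \<in> simplices V E. f \<sigma> < f e'} \<subset> {\<sigma> \<in> simplices V E. f \<sigma> < f e}"
        using 2 a(2) by (auto simp: simplices_def)
      then have "card {\<sigma> \<in> simplices V E. f \<sigma> < f e'} < card {\<sigma> \<in> simplices V E. f \<sigma> < f e}"
        using finite_simplices[OF assms(1)] by (intro psubset_card_mono) auto
      then show ?thesis using less.hyps 2 by auto
    qed
  qed
  have "{a, b} \<in> E" "f {a, b} = f e" using less.prems e by auto
  \<comment> \<open>The single node from \<open>B\<close> may be on either side; if \<open>A\<close>
    also gives a single node, \<open>both\<close> applies, otherwise \<open>left\<close> or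
    \<open>right\<close>.\<close>
  from merge_subtree_edge_cases[OF assms(1,2) this, of d] show ?case
    by cases (use A B in \<open>metis caterpillar.intros\<close>)+
qed

theorem proposition21:
  fixes n :: nat and V :: "'a set" and E :: "'a set set" and f :: "'a set \<Rightarrow> real"
  assumes "n \<ge> 2"
    and "star_graph n V E"
    and "critical_discrete_morse V E f"
  shows "num_impasses (merge_tree V E f) = 1"
proof -
  have simple: "simple_graph V E"
    using assms(2) unfolding star_graph_def by (rule complete_bipartite_simple_graph)
  obtain A B where AB: "finite B" "card A = 1" "card B = n - 1" "A \<inter> B = {}" "V = A \<union> B"
      "E = {{a, b} | a b. a \<in> A \<and> b \<in> B}"
    using assms(2) unfolding star_graph_def complete_bipartite_def by blast
  obtain a where a: "A = {a}" using AB(2) by (auto simp: card_1_singleton_iff)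
  have E: "E = {{a, b} | b. b \<in> B}" using AB(6) a by auto
  have "a \<notin> B" using AB(4) a by simp
  \<comment> \<open>Here \<open>n \<ge> 2\<close> enters: \<open>n - 1\<close> is positive.\<close>
  obtain b where "b \<in> B" using AB(1,3) assms(1) by fastforce
  have incident: "\<exists>e\<in>E. v \<in> e" if "v \<in> V" for v
    using that \<open>b \<in> B\<close> AB(5) a E by blast
  have "Max (f ` simplices V E) \<in> f ` simplices V E"
    using finite_simplices[OF simple] \<open>b \<in> B\<close> AB(5) by (intro Max_in) (auto simp: simplices_def)
  then obtain \<sigma> where \<sigma>: "\<sigma> \<in> simplices V E" "Max (f ` simplices V E) = f \<sigma>" by auto
  \<comment> \<open>Every vertex, the centre included, has an edge above it, so the maximum is
    attained on an edge and the root has children.\<close>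
  have "\<sigma> \<in> E"
  proof (rule ccontr)
    assume "\<sigma> \<notin> E"
    then obtain v where "v \<in> V" "\<sigma> = {v}" using \<sigma>(1) by (auto simp: simplices_def)
    then obtain e where "e \<in> E" "f \<sigma> < f e"
      using incident vertex_less_edge(2)[OF simple assms(3)] by blast
    moreover have "f e \<le> f \<sigma>"
      using \<open>e \<in> E\<close> finite_simplices[OF simple] unfolding \<sigma>(2)[symmetric]
      by (intro Max_ge) (auto simp: simplices_def)
    ultimately show False by simp
  qed
  \<comment> \<open>The pendant end is the one in \<open>B\<close>; since
    \<open>a \<notin> B\<close>, it is not the centre.\<close>
  moreover have "\<exists>a b. e = {a, b} \<and> (\<forall>e'\<in>E. b \<in> e' \<longrightarrow> e' = e)" if "e \<in> E" for e
    using that \<open>a \<notin> B\<close> unfolding E by blast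
  ultimately have "caterpillar (merge_tree V E f)"
    unfolding merge_tree_def \<sigma>(2) using caterpillar_merge_subtree[OF simple assms(3)] by blast
  then show ?thesis
    using caterpillar_impasse unfolding num_impasses_def by fastforce
qed

end
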